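(* Let $\vec S$ be a separation system that is contained in some universe of separations $\vec U$ and is structurally submodular in $\vec U$, and let $\mathcal P$ be a set of profiles of $S$ (with respect to $\vec U$). Then there is a nested set $N=N(\vec S,\mathcal P)\subseteq S$ which distinguishes $\mathcal P$. This $N(\vec S,\mathcal P)$ can be chosen canonically: if $\varphi\colon\vec S\to\vec S'$ is an isomorphism of separation systems and $\mathcal P':=\{\varphi(P)\mid P\in\mathcal P\}$, then $\varphi(N(\vec S,\mathcal P))=N(\vec S',\mathcal P')$.
   Context: A separation system $\vec S=(\vec S,\le,{}^* )$ is a poset $(\vec S,\le)$ together with an order-reversing involution ${}^*$ on $\vec S$, so $\vec r\le\vec s$ if and only if $\vec s^{\,*}\le\vec r^{\,*}$. Elements $\vec s\in\vec S$ are called oriented separations; $\vec s^{\,*}$ is the inverse of $\vec s$; the underlying unoriented separation is $s=\{\vec s,\vec s^{\,*}\}$, whose orientations are $\vec s$ and $\vec s^{\,*}$. $S$ denotes the set of all unoriented separations $s$ with $\vec s\in\vec S$. Two unoriented separations $r,s$ are nested if they have orientations $\vec r,\vec s$ with $\vec r\le\vec s$. A set of separations is nested if its elements are pairwise nested. A universe of separations is a separation system $\vec U$ whose poset is a lattice, with pairwise join $\vee$ and meet $\wedge$. For a universe $\vec U$ and a separation system $\vec S\subseteq\vec U$ (with the order and involution induced from $\vec U$), $\vec S$ is structurally submodular in $\vec U$ if for all $\vec r,\vec s\in\vec S$ at least one of $\vec r\vee\vec s$ and $\vec r\wedge\vec s$ (taken in $\vec U$) lies in $\vec S$. An orientation of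 $S$ is a set $O\subseteq\vec S$ containing exactly one orientation $\vec s$ or $\vec s^{\,*}$ of each $s=\{\vec s,\vec s^{\,*}\}\in S$. It is consistent if there are no $\vec r,\vec s\in O$ with $r\ne s$ and $\vec r^{\,*}\le\vec s$. A profile of $S$ (with respect to $\vec U\supseteq\vec S$) is a consistent orientation $P$ of $S$ such that $(\vec r^{\,*}\wedge\vec s^{\,*})\notin P$ for all $\vec r,\vec s\in P$ (meet taken in $\vec U$). A separation $s\in S$ distinguishes two profiles $P,Q$ of $S$ if it has an orientation $\vec s$ with $\vec s\in P$ and $\vec s^{\,*}\in Q$. A set $N\subseteq S$ distinguishes $\mathcal P$ if every pair of distinct elements of $\mathcal P$ is distinguished by some $s\in N$. An isomorphism of separation systems $\vec S,\vec S'$ is a bijection $\varphi\colon\vec S\to\vec S'$ with $\varphi(\vec s^{\,*})=\varphi(\vec s)^*$ for all $\vec s\in\vec S$, and $\vec r\le\vec s\iff\varphi(\vec r)\le\varphi(\vec s)$ for all $\vec r,\vec s\in\vec S$. It acts on unoriented separations by $\varphi(s)=\{\varphi(\vec s),\varphi(\vec s^{\,*})\}$, on sets of them elementwise, and $\varphi(P)$ is the image of $P\subseteq\vec S$. The notation $N(\vec S,\mathcal P)$ indicates that the set depends only on $\vec S$ and $\mathcal P$.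
   Formalization: The separation system S is assumed finite (the universe U need not be), since the canonical claim fails for infinite S; and S, S' and U are all taken inside one arbitrary common ground set, to which the general case reduces by isomorphism. *)

theory Defs
  imports "HOL-Algebra.Lattice"
begin

text \<open>
  Posets and lattices are the carrier-based ones of \<open>HOL-Algebra\<close>, extended by an involution.
  In a lattice \<open>U\<close>, the terms \<open>x \<squnion>\<^bsub>U\<^esub> y\<close> and \<open>x \<sqinter>\<^bsub>U\<^esub> y\<close> are joins and meets in \<open>U\<close>.
\<close>

record 'a sepsys = "'a gorder" +
  sinv :: "'a \<Rightarrow> 'a"

locale separation_system = partial_order S for S (structure) +
  assumes sinv_closed: "x \<in> carrier S \<Longrightarrow> sinv S x \<in> carrier S"
    and sinv_sinv: "x \<in> carrier S \<Longrightarrow> sinv S (sinv S x) = x"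
    and sinv_le_iff: "\<lbrakk>x \<in> carrier S; y \<in> carrier S\<rbrakk> \<Longrightarrow> x \<sqsubseteq> y \<longleftrightarrow> sinv S y \<sqsubseteq> sinv S x"

locale separation_universe = separation_system U + lattice U for U (structure)

text \<open>The order and the involution of \<open>S\<close> are those induced from \<open>U\<close>.\<close>

definition subsystem :: "'a sepsys \<Rightarrow> 'a sepsys \<Rightarrow> bool" where
  "subsystem S U \<longleftrightarrow> carrier S \<subseteq> carrier U
    \<and> (\<forall>x\<in>carrier S. \<forall>y\<in>carrier S. x \<sqsubseteq>\<^bsub>S\<^esub> y \<longleftrightarrow> x \<sqsubseteq>\<^bsub>U\<^esub> y)
    \<and> (\<forall>x\<in>carrier S. sinv S x = sinv U x)"

definition structurally_submodular :: "'a sepsys \<Rightarrow> 'a sepsys \<Rightarrow> bool" where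
  "structurally_submodular S U \<longleftrightarrow>
    (\<forall>x\<in>carrier S. \<forall>y\<in>carrier S. x \<squnion>\<^bsub>U\<^esub> y \<in> carrier S \<or> x \<sqinter>\<^bsub>U\<^esub> y \<in> carrier S)"

text \<open>
  Oriented separations are elements of the carrier. An unoriented separation is the set of its
  orientations, so the orientations of an unoriented separation are its elements.
\<close>

definition underlying :: "'a sepsys \<Rightarrow> 'a \<Rightarrow> 'a set" where
  "underlying S x = {x, sinv S x}"

definition unoriented :: "'a sepsys \<Rightarrow> 'a set set" where
  "unoriented S = underlying S ` carrier S"

definition nested :: "'a sepsys \<Rightarrow> 'a set \<Rightarrow> 'a set \<Rightarrow> bool" where
  "nested S r s \<longleftrightarrow> (\<exists>x\<in>r. \<exists>y\<in>s. x \<sqsubseteq>\<^bsub>S\<^esub> y)"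

definition nested_set :: "'a sepsys \<Rightarrow> 'a set set \<Rightarrow> bool" where
  "nested_set S N \<longleftrightarrow> (\<forall>r\<in>N. \<forall>s\<in>N. nested S r s)"

definition orientation :: "'a sepsys \<Rightarrow> 'a set \<Rightarrow> bool" where
  "orientation S P \<longleftrightarrow> P \<subseteq> carrier S \<and> (\<forall>s\<in>unoriented S. \<exists>!x. x \<in> s \<and> x \<in> P)"

definition consistent :: "'a sepsys \<Rightarrow> 'a set \<Rightarrow> bool" where
  "consistent S P \<longleftrightarrow>
    \<not> (\<exists>x\<in>P. \<exists>y\<in>P. underlying S x \<noteq> underlying S y \<and> sinv S x \<sqsubseteq>\<^bsub>S\<^esub> y)"

definition profile :: "'a sepsys \<Rightarrow> 'a sepsys \<Rightarrow> 'a set \<Rightarrow> bool" where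
  "profile S U P \<longleftrightarrow> orientation S P \<and> consistent S P
    \<and> (\<forall>x\<in>P. \<forall>y\<in>P. sinv S x \<sqinter>\<^bsub>U\<^esub> sinv S y \<notin> P)"

definition distinguishes :: "'a sepsys \<Rightarrow> 'a set \<Rightarrow> 'a set \<Rightarrow> 'a set \<Rightarrow> bool" where
  "distinguishes S s P Q \<longleftrightarrow> (\<exists>x\<in>s. x \<in> P \<and> sinv S x \<in> Q)"

definition distinguishes_set :: "'a sepsys \<Rightarrow> 'a set set \<Rightarrow> 'a set set \<Rightarrow> bool" where
  "distinguishes_set S N \<P> \<longleftrightarrow>
    (\<forall>P\<in>\<P>. \<forall>Q\<in>\<P>. P \<noteq> Q \<longrightarrow> (\<exists>s\<in>N. distinguishes S s P Q))"

text \<open>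
  An isomorphism \<open>\<phi>\<close> acts on sets of oriented separations, and so on unoriented separations and
  on profiles, by \<open>image \<phi>\<close>, and on sets of either by \<open>image (image \<phi>)\<close>.
\<close>

definition sepsys_iso :: "'a sepsys \<Rightarrow> 'a sepsys \<Rightarrow> ('a \<Rightarrow> 'a) \<Rightarrow> bool" where
  "sepsys_iso S S' \<phi> \<longleftrightarrow> bij_betw \<phi> (carrier S) (carrier S')
    \<and> (\<forall>x\<in>carrier S. \<phi> (sinv S x) = sinv S' (\<phi> x))
    \<and> (\<forall>x\<in>carrier S. \<forall>y\<in>carrier S. x \<sqsubseteq>\<^bsub>S\<^esub> y \<longleftrightarrow> \<phi> x \<sqsubseteq>\<^bsub>S'\<^esub> \<phi> y)"

text \<open>
  Conventions for the canonical tree-of-tangles theorem stated with these notions.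

  \<^item> The separation system is finite, as is usual in this theory; the surrounding universe need
    not be. Finiteness cannot be dropped: for the bipartitions of a countably infinite set, a
    distinguishing set for all profiles would generate the Boolean algebra of all subsets, while
    the algebra generated by a nested set has no uncountable independent family.

  \<^item> The canonical choice is one function \<open>N\<close> of the system and the set of profiles; the universe is
    not an argument. As \<open>N\<close> has to have a type, all systems are carried by subsets of one
    arbitrary type. Systems over two types \<open>'b\<close> and \<open>'c\<close> are compared inside \<open>'b + 'c\<close>. Taking
    \<open>\<phi>\<close> to be the identity shows that \<open>N\<close> ignores the values of order and involution outside
    the carrier.
\<close>

end

theory Submission
  imports Defs
begin

text \<open>
  Call a separation exclusive for a profile \<open>P\<close> in \<open>\<P>\<close> if \<open>P\<close> is the only element of \<open>\<P>\<close> that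
  contains it. Submodularity makes the maximal exclusive separations of different profiles \<open>P\<close>
  and \<open>Q\<close> nested: if \<open>r\<close> and \<open>s\<close> are such, then one of \<open>r \<squnion> s\<^sup>*\<close> and \<open>s \<squnion> r\<^sup>*\<close> lies in the
  system, is again exclusive for \<open>P\<close> or \<open>Q\<close>, and so equals \<open>r\<close> or \<open>s\<close> by maximality; either way
  \<open>r\<^sup>* \<le> s\<close> (\<open>max_exclusive_disjoint\<close>). A single profile may have several maximal exclusive
  separations, and they may cross. But meeting any separation of \<open>P\<close> with a maximal exclusive
  one never leaves the system (\<open>meet_max_exclusive\<close>), so the infimum of all of them exists. It is
  still exclusive for \<open>P\<close> (\<open>leaf_exists\<close>), and it is determined by the order alone: this is the
  leaf of \<open>P\<close>. Leaves of different profiles \<open>P\<close>, \<open>Q\<close> satisfy \<open>m\<^sup>* \<le> m'\<close> (\<open>leaf_disjoint\<close>), and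
  the leaf of \<open>P\<close> distinguishes \<open>P\<close> from all other profiles.

  As soon as there are two profiles, at least one of them has an exclusive separation
  (\<open>exclusive_exists\<close>). So one collects the leaves, discards their profiles, and repeats. To keep
  later leaves nested with earlier ones, the system is cut down to those \<open>s\<close> with an orientation
  above \<open>m\<^sup>*\<close> for every leaf \<open>m\<close>. This condition is preserved by joins, meets and inverses, so the
  smaller system is submodular with the same universe (\<open>submodular_pointing\<close>). It still
  separates the remaining profiles (\<open>separated_pointing\<close>): such a profile contains \<open>r\<^sup>*\<close> for each
  \<open>r\<close> that is exclusive for a discarded profile \<open>R\<close>, so a separation that distinguishes two
  remaining profiles, oriented as in \<open>R\<close>, can be replaced by its meet with \<open>r\<close>. Repeating this
  for all maximal \<open>r\<close> pushes it below the leaf of \<open>R\<close>.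

  The construction refers only to the order and the involution of the system, while the universe
  supplies the corners in the proofs. Hence the result commutes with isomorphisms.
\<close>

section \<open>Construction from order and involution\<close>

definition exclusive :: "'a set \<Rightarrow> 'a set set \<Rightarrow> 'a set \<Rightarrow> 'a set" where
  "exclusive T \<P> P = {x\<in>T. {Q\<in>\<P>. x \<in> Q} = {P}}"

definition max_exclusive :: "'a sepsys \<Rightarrow> 'a set \<Rightarrow> 'a set set \<Rightarrow> 'a set \<Rightarrow> 'a set" where
  "max_exclusive S T \<P> P =
    {x\<in>exclusive T \<P> P. \<forall>y\<in>exclusive T \<P> P. x \<sqsubseteq>\<^bsub>S\<^esub> y \<longrightarrow> y = x}"

text \<open>
  The infimum in \<open>T\<close> of the maximal exclusive separations of \<open>P\<close>, as a set with at most one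
  element: no choice is involved, so that isomorphisms carry leaves to leaves. It is required to be
  exclusive itself, which leaves the set empty when \<open>P\<close> has no exclusive separation.
\<close>

definition leaf :: "'a sepsys \<Rightarrow> 'a set \<Rightarrow> 'a set set \<Rightarrow> 'a set \<Rightarrow> 'a set" where
  "leaf S T \<P> P = {m\<in>exclusive T \<P> P. (\<forall>r\<in>max_exclusive S T \<P> P. m \<sqsubseteq>\<^bsub>S\<^esub> r) \<and>
     (\<forall>x\<in>T. (\<forall>r\<in>max_exclusive S T \<P> P. x \<sqsubseteq>\<^bsub>S\<^esub> r) \<longrightarrow> x \<sqsubseteq>\<^bsub>S\<^esub> m)}"

definition leaves :: "'a sepsys \<Rightarrow> 'a set \<times> 'a set set \<Rightarrow> 'a set" where
  "leaves S = (\<lambda>(T, \<P>). \<Union>P\<in>\<P>. leaf S T \<P> P)"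

lemma leaves_subset: "leaves S (T, \<P>) \<subseteq> T"
  by (auto simp: leaves_def leaf_def exclusive_def)

lemmas leaves_in = subsetD[OF leaves_subset]

text \<open>
  Some orientation of \<open>s\<close> lies above \<open>m\<^sup>*\<close>. This is stronger than being nested with \<open>m\<close>: it
  excludes that an orientation of \<open>s\<close> lies strictly below \<open>m\<^sup>*\<close> while none lies above it. Unlike
  nestedness, it passes to both corners of any two separations (\<open>points_to_join\<close>).
\<close>

definition points_to :: "'a sepsys \<Rightarrow> 'a \<Rightarrow> 'a \<Rightarrow> bool" where
  "points_to S s m \<longleftrightarrow> sinv S m \<sqsubseteq>\<^bsub>S\<^esub> s \<or> sinv S m \<sqsubseteq>\<^bsub>S\<^esub> sinv S s"

definition pointing :: "'a sepsys \<Rightarrow> 'a set \<Rightarrow> 'a set \<Rightarrow> 'a set" where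
  "pointing S T L = {s\<in>T. \<forall>m\<in>L. points_to S s m}"

definition step :: "'a sepsys \<Rightarrow> 'a set \<times> 'a set set \<Rightarrow> 'a set \<times> 'a set set" where
  "step S = (\<lambda>(T, \<P>). (pointing S T (leaves S (T, \<P>)), {P\<in>\<P>. exclusive T \<P> P = {}}))"

text \<open>
  The construction needs at most as many steps as there are profiles; all finite stages are
  admitted so that no termination argument enters the definition.
\<close>

definition stage :: "'a sepsys \<Rightarrow> 'a set set \<Rightarrow> nat \<Rightarrow> 'a set \<times> 'a set set" where
  "stage S \<P> n = (step S ^^ n) (carrier S, \<P>)"

definition canonical_tree :: "'a sepsys \<Rightarrow> 'a set set \<Rightarrow> 'a set set" where
  "canonical_tree S \<P> = underlying S ` (\<Union>n. leaves S (stage S \<P> n))"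

section \<open>Canonicity\<close>

text \<open>
  Every ingredient of the construction is expressed through order, involution and membership in
  profiles, all of which an isomorphism preserves. Profiles are treated here as mere subsets of the
  carrier: being a profile refers to the universe, which an isomorphism need not respect.
\<close>

locale iso_pair =
  fixes S S' :: "'a sepsys" and \<phi> :: "'a \<Rightarrow> 'a"
  assumes iso: "sepsys_iso S S' \<phi>"
    and sinv_in: "x \<in> carrier S \<Longrightarrow> sinv S x \<in> carrier S"
begin

lemma inj: "inj_on \<phi> (carrier S)" and onto: "\<phi> ` carrier S = carrier S'"
  using iso by (auto simp: sepsys_iso_def bij_betw_def)

lemma iso_inv: "x \<in> carrier S \<Longrightarrow> sinv S' (\<phi> x) = \<phi> (sinv S x)"
  using iso by (auto simp: sepsys_iso_def)

lemma iso_le: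
  "\<lbrakk>x \<in> carrier S; y \<in> carrier S\<rbrakk> \<Longrightarrow> \<phi> x \<sqsubseteq>\<^bsub>S'\<^esub> \<phi> y \<longleftrightarrow> x \<sqsubseteq>\<^bsub>S\<^esub> y"
  using iso by (auto simp: sepsys_iso_def)

lemma iso_mem: "\<lbrakk>x \<in> carrier S; P \<subseteq> carrier S\<rbrakk> \<Longrightarrow> \<phi> x \<in> \<phi> ` P \<longleftrightarrow> x \<in> P"
  using inj by (meson inj_on_image_mem_iff)

lemma iso_exclusive:
  assumes T: "T \<subseteq> carrier S" and \<P>: "\<P> \<subseteq> Pow (carrier S)" and P: "P \<subseteq> carrier S"
  shows "exclusive (\<phi> ` T) (image \<phi> ` \<P>) (\<phi> ` P) = \<phi> ` exclusive T \<P> P"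
  unfolding exclusive_def Compr_image_eq
proof (intro arg_cong[where f = "image \<phi>"] Collect_cong conj_cong refl)
  fix x assume "x \<in> T"
  with T have x: "x \<in> carrier S" by auto
  have "{Q \<in> \<P>. \<phi> x \<in> \<phi> ` Q} = {Q \<in> \<P>. x \<in> Q}"
  proof (intro Collect_cong conj_cong refl)
    fix Q assume "Q \<in> \<P>"
    with \<P> have "Q \<subseteq> carrier S" by auto
    then show "\<phi> x \<in> \<phi> ` Q \<longleftrightarrow> x \<in> Q" by (rule iso_mem[OF x])
  qed
  moreover have "image \<phi> ` A = {\<phi> ` P} \<longleftrightarrow> A = {P}" if "A \<subseteq> \<P>" for A
  proof -
    have "inj_on (image \<phi>) (Pow (carrier S))" using inj by (simp add: inj_on_image_Pow)
    moreover have "A \<subseteq> Pow (carrier S)" "{P} \<subseteq> Pow (carrier S)" using that \<P> P by auto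
    ultimately have "image \<phi> ` A = image \<phi> ` {P} \<longleftrightarrow> A = {P}" by (meson inj_on_image_eq_iff)
    then show ?thesis by simp
  qed
  ultimately show "image \<phi> ` {Q \<in> \<P>. \<phi> x \<in> \<phi> ` Q} = {\<phi> ` P} \<longleftrightarrow> {Q \<in> \<P>. x \<in> Q} = {P}"
    by (metis (lifting) mem_Collect_eq subsetI)
qed

lemma iso_max_exclusive:
  assumes T: "T \<subseteq> carrier S" and \<P>: "\<P> \<subseteq> Pow (carrier S)" and P: "P \<subseteq> carrier S"
  shows "max_exclusive S' (\<phi> ` T) (image \<phi> ` \<P>) (\<phi> ` P) = \<phi> ` max_exclusive S T \<P> P"
proof -
  have E: "x \<in> exclusive T \<P> P \<Longrightarrow> x \<in> carrier S" for x using T by (auto simp: exclusive_def)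
  show ?thesis
    unfolding max_exclusive_def iso_exclusive[OF assms] Compr_image_eq
    by (rule arg_cong[where f = "image \<phi>"]) (auto simp: iso_le E inj_on_eq_iff[OF inj])
qed

lemma iso_leaf:
  assumes T: "T \<subseteq> carrier S" and \<P>: "\<P> \<subseteq> Pow (carrier S)" and P: "P \<subseteq> carrier S"
  shows "leaf S' (\<phi> ` T) (image \<phi> ` \<P>) (\<phi> ` P) = \<phi> ` leaf S T \<P> P"
proof -
  have E: "x \<in> exclusive T \<P> P \<Longrightarrow> x \<in> carrier S" for x using T by (auto simp: exclusive_def)
  have M: "x \<in> max_exclusive S T \<P> P \<Longrightarrow> x \<in> carrier S" for x
    using E by (auto simp: max_exclusive_def)
  have below: "(\<forall>r\<in>\<phi> ` max_exclusive S T \<P> P. \<phi> x \<sqsubseteq>\<^bsub>S'\<^esub> r) \<longleftrightarrow>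
      (\<forall>r\<in>max_exclusive S T \<P> P. x \<sqsubseteq>\<^bsub>S\<^esub> r)" if "x \<in> carrier S" for x
    using that M by (simp add: iso_le)
  have greatest: "(\<forall>x\<in>\<phi> ` T. (\<forall>r\<in>\<phi> ` max_exclusive S T \<P> P. x \<sqsubseteq>\<^bsub>S'\<^esub> r) \<longrightarrow> x \<sqsubseteq>\<^bsub>S'\<^esub> \<phi> m) \<longleftrightarrow>
      (\<forall>x\<in>T. (\<forall>r\<in>max_exclusive S T \<P> P. x \<sqsubseteq>\<^bsub>S\<^esub> r) \<longrightarrow> x \<sqsubseteq>\<^bsub>S\<^esub> m)"
    if m: "m \<in> carrier S" for m
    unfolding ball_simps(9)[of \<phi> T]
  proof (rule ball_cong[OF refl])
    fix x assume "x \<in> T"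
    with T have x: "x \<in> carrier S" by auto
    show "((\<forall>r\<in>\<phi> ` max_exclusive S T \<P> P. \<phi> x \<sqsubseteq>\<^bsub>S'\<^esub> r) \<longrightarrow> \<phi> x \<sqsubseteq>\<^bsub>S'\<^esub> \<phi> m) \<longleftrightarrow>
        ((\<forall>r\<in>max_exclusive S T \<P> P. x \<sqsubseteq>\<^bsub>S\<^esub> r) \<longrightarrow> x \<sqsubseteq>\<^bsub>S\<^esub> m)"
      by (simp only: below[OF x] iso_le[OF x m])
  qed
  show ?thesis
    unfolding leaf_def iso_exclusive[OF assms] iso_max_exclusive[OF assms] Compr_image_eq
    by (intro arg_cong[where f = "image \<phi>"] Collect_cong conj_cong refl below greatest E)
qed

lemma iso_leaves:
  assumes T: "T \<subseteq> carrier S" and \<P>: "\<P> \<subseteq> Pow (carrier S)"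
  shows "leaves S' (\<phi> ` T, image \<phi> ` \<P>) = \<phi> ` leaves S (T, \<P>)"
proof -
  have "leaf S' (\<phi> ` T) (image \<phi> ` \<P>) (\<phi> ` P) = \<phi> ` leaf S T \<P> P" if "P \<in> \<P>" for P
    using iso_leaf[OF assms] that \<P> by blast
  then show ?thesis by (simp add: leaves_def image_UN)
qed

lemma iso_pointing:
  assumes T: "T \<subseteq> carrier S" and L: "L \<subseteq> carrier S"
  shows "pointing S' (\<phi> ` T) (\<phi> ` L) = \<phi> ` pointing S T L"
  unfolding pointing_def points_to_def Compr_image_eq
proof (intro arg_cong[where f = "image \<phi>"] Collect_cong conj_cong refl)
  fix x assume "x \<in> T"
  with T have "x \<in> carrier S" by auto
  then show "(\<forall>m\<in>\<phi> ` L. sinv S' m \<sqsubseteq>\<^bsub>S'\<^esub> \<phi> x \<or> sinv S' m \<sqsubseteq>\<^bsub>S'\<^esub> sinv S' (\<phi> x)) \<longleftrightarrow>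
    (\<forall>m\<in>L. sinv S m \<sqsubseteq>\<^bsub>S\<^esub> x \<or> sinv S m \<sqsubseteq>\<^bsub>S\<^esub> sinv S x)"
    using L by (simp add: subset_iff iso_inv iso_le sinv_in)
qed

lemma iso_stage:
  assumes "\<P> \<subseteq> Pow (carrier S)" and "stage S \<P> n = (T, \<Q>)"
  shows "T \<subseteq> carrier S \<and> \<Q> \<subseteq> Pow (carrier S) \<and>
    stage S' (image \<phi> ` \<P>) n = (\<phi> ` T, image \<phi> ` \<Q>)"
  using assms(2)
proof (induction n arbitrary: T \<Q>)
  case 0
  then show ?case using assms(1) onto by (auto simp: stage_def)
next
  case (Suc n)
  obtain T0 \<Q>0 where s: "stage S \<P> n = (T0, \<Q>0)" by fastforce
  note IH = Suc.IH[OF s]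
  have L: "leaves S (T0, \<Q>0) \<subseteq> carrier S" using IH leaves_subset[of S T0 \<Q>0] by blast
  have T: "T = pointing S T0 (leaves S (T0, \<Q>0))"
    and Q: "\<Q> = {P\<in>\<Q>0. exclusive T0 \<Q>0 P = {}}"
    using Suc.prems s by (simp_all add: stage_def step_def)
  have "{P \<in> image \<phi> ` \<Q>0. exclusive (\<phi> ` T0) (image \<phi> ` \<Q>0) P = {}} = image \<phi> ` \<Q>"
    unfolding Compr_image_eq Q
  proof (intro arg_cong[where f = "image (image \<phi>)"] Collect_cong conj_cong refl)
    fix P assume "P \<in> \<Q>0"
    then show "exclusive (\<phi> ` T0) (image \<phi> ` \<Q>0) (\<phi> ` P) = {} \<longleftrightarrow> exclusive T0 \<Q>0 P = {}"
      using IH iso_exclusive[of T0 \<Q>0 P] by blast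
  qed
  then have "stage S' (image \<phi> ` \<P>) (Suc n) = (\<phi> ` T, image \<phi> ` \<Q>)"
    using IH iso_pointing[OF _ L] iso_leaves T
    by (simp add: stage_def step_def)
  then show ?case using IH T Q by (auto simp: pointing_def)
qed

lemma iso_canonical_tree:
  assumes "\<P> \<subseteq> Pow (carrier S)"
  shows "image \<phi> ` canonical_tree S \<P> = canonical_tree S' (image \<phi> ` \<P>)"
proof -
  have "leaves S (stage S \<P> n) \<subseteq> carrier S \<and>
      leaves S' (stage S' (image \<phi> ` \<P>) n) = \<phi> ` leaves S (stage S \<P> n)" for n
  proof -
    obtain T \<Q> where s: "stage S \<P> n = (T, \<Q>)" by fastforce
    note t = iso_stage[OF assms s]
    have "leaves S (T, \<Q>) \<subseteq> carrier S" using t leaves_subset[of S T \<Q>] by (meson subset_trans)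
    then show ?thesis using t iso_leaves s by simp
  qed
  moreover have "\<phi> ` underlying S x = underlying S' (\<phi> x)" if "x \<in> carrier S" for x
    using that by (simp add: underlying_def iso_inv)
  ultimately have "image \<phi> ` underlying S ` leaves S (stage S \<P> n) =
      underlying S' ` leaves S' (stage S' (image \<phi> ` \<P>) n)" for n
    by (auto simp: image_image subset_iff intro!: image_cong)
  then show ?thesis by (simp add: canonical_tree_def image_UN)
qed

end

section \<open>Profiles in a submodular system\<close>

definition splits :: "'a \<Rightarrow> 'a set \<Rightarrow> 'a set \<Rightarrow> bool" where
  "splits s P Q \<longleftrightarrow> (s \<in> P \<longleftrightarrow> s \<notin> Q)"

locale system_in_universe =
  fixes S U :: "'a sepsys"
  assumes S: "separation_system S" and U: "separation_universe U" and sub: "subsystem S U"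
begin

abbreviation le (infix "\<preceq>" 50) where "x \<preceq> y \<equiv> x \<sqsubseteq>\<^bsub>S\<^esub> y"
abbreviation inv ("_\<^sup>\<star>" [1000] 999) where "x\<^sup>\<star> \<equiv> sinv S x"
abbreviation join (infixl "\<squnion>\<^sub>U" 65) where "x \<squnion>\<^sub>U y \<equiv> x \<squnion>\<^bsub>U\<^esub> y"

context
begin

interpretation S: separation_system S by (fact S)
interpretation U: separation_universe U by (fact U)

lemma in_U: "x \<in> carrier S \<Longrightarrow> x \<in> carrier U"
  using sub by (auto simp: subsystem_def)

lemma le_U: "\<lbrakk>x \<in> carrier S; y \<in> carrier S\<rbrakk> \<Longrightarrow> x \<preceq> y \<longleftrightarrow> x \<sqsubseteq>\<^bsub>U\<^esub> y"
  using sub by (auto simp: subsystem_def)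

lemma inv_U: "x \<in> carrier S \<Longrightarrow> sinv U x = x\<^sup>\<star>"
  using sub by (auto simp: subsystem_def)

lemmas inv_in [simp] = S.sinv_closed
lemmas inv_inv [simp] = S.sinv_sinv
lemmas le_refl [simp] = S.le_refl
lemmas le_trans = S.le_trans
lemmas le_antisym = S.le_antisym

lemma inv_le: "\<lbrakk>x \<in> carrier S; y \<in> carrier S\<rbrakk> \<Longrightarrow> x\<^sup>\<star> \<preceq> y\<^sup>\<star> \<longleftrightarrow> y \<preceq> x"
  using S.sinv_le_iff by blast

lemma inv_le_swap: "\<lbrakk>x \<in> carrier S; y \<in> carrier S\<rbrakk> \<Longrightarrow> x\<^sup>\<star> \<preceq> y \<longleftrightarrow> y\<^sup>\<star> \<preceq> x"
  using inv_le[of x "y\<^sup>\<star>"] by simp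

lemma le_join1: "\<lbrakk>x \<in> carrier S; y \<in> carrier S; x \<squnion>\<^sub>U y \<in> carrier S\<rbrakk> \<Longrightarrow> x \<preceq> x \<squnion>\<^sub>U y"
  by (simp add: le_U U.join_left in_U)

lemma le_join2: "\<lbrakk>x \<in> carrier S; y \<in> carrier S; x \<squnion>\<^sub>U y \<in> carrier S\<rbrakk> \<Longrightarrow> y \<preceq> x \<squnion>\<^sub>U y"
  by (simp add: le_U U.join_right in_U)

lemma join_le:
  "\<lbrakk>x \<preceq> z; y \<preceq> z; x \<in> carrier S; y \<in> carrier S; z \<in> carrier S; x \<squnion>\<^sub>U y \<in> carrier S\<rbrakk>
    \<Longrightarrow> x \<squnion>\<^sub>U y \<preceq> z"
  by (simp add: le_U U.join_le in_U)

text \<open>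
  De Morgan's law turns meets into joins. From here on the corners of \<open>x\<close> and \<open>y\<close> are written as
  \<open>x \<squnion> y\<close> and \<open>(x\<^sup>* \<squnion> y\<^sup>*)\<^sup>*\<close>, the latter being the meet.
\<close>

lemma meet_inv:
  assumes "x \<in> carrier S" "y \<in> carrier S"
  shows "x\<^sup>\<star> \<sqinter>\<^bsub>U\<^esub> y\<^sup>\<star> = sinv U (x \<squnion>\<^sub>U y)"
proof (rule U.le_antisym)
  note x = in_U[OF assms(1)] in_U[OF inv_in[OF assms(1)]]
    and y = in_U[OF assms(2)] in_U[OF inv_in[OF assms(2)]]
  have inv: "sinv U (x\<^sup>\<star>) = x" "sinv U (y\<^sup>\<star>) = y" using assms by (simp_all add: inv_U)
  have c: "x\<^sup>\<star> \<sqinter>\<^bsub>U\<^esub> y\<^sup>\<star> \<in> carrier U" "x \<squnion>\<^sub>U y \<in> carrier U" using x y by auto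
  note d = U.sinv_closed[OF c(1)] U.sinv_closed[OF c(2)]
  show "x\<^sup>\<star> \<sqinter>\<^bsub>U\<^esub> y\<^sup>\<star> \<in> carrier U" "sinv U (x \<squnion>\<^sub>U y) \<in> carrier U" using c d by auto
  have "x \<sqsubseteq>\<^bsub>U\<^esub> sinv U (x\<^sup>\<star> \<sqinter>\<^bsub>U\<^esub> y\<^sup>\<star>)" "y \<sqsubseteq>\<^bsub>U\<^esub> sinv U (x\<^sup>\<star> \<sqinter>\<^bsub>U\<^esub> y\<^sup>\<star>)"
    using U.meet_left[OF x(2) y(2)] U.meet_right[OF x(2) y(2)] U.sinv_le_iff c x y inv by metis+
  then have "x \<squnion>\<^sub>U y \<sqsubseteq>\<^bsub>U\<^esub> sinv U (x\<^sup>\<star> \<sqinter>\<^bsub>U\<^esub> y\<^sup>\<star>)" using U.join_le x y d by blast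
  then show "x\<^sup>\<star> \<sqinter>\<^bsub>U\<^esub> y\<^sup>\<star> \<sqsubseteq>\<^bsub>U\<^esub> sinv U (x \<squnion>\<^sub>U y)"
    using U.sinv_le_iff c d U.sinv_sinv by metis
  have "sinv U (x \<squnion>\<^sub>U y) \<sqsubseteq>\<^bsub>U\<^esub> x\<^sup>\<star>" "sinv U (x \<squnion>\<^sub>U y) \<sqsubseteq>\<^bsub>U\<^esub> y\<^sup>\<star>"
    using U.join_left[OF x(1) y(1)] U.join_right[OF x(1) y(1)] U.sinv_le_iff c x y
      inv_U[OF assms(1)] inv_U[OF assms(2)] by metis+
  then show "sinv U (x \<squnion>\<^sub>U y) \<sqsubseteq>\<^bsub>U\<^esub> x\<^sup>\<star> \<sqinter>\<^bsub>U\<^esub> y\<^sup>\<star>" using U.meet_le x y d by blast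
qed

text \<open>
  Structural submodularity for a subset of the system that is closed under the involution, with the
  meet of \<open>x\<close> and \<open>y\<close> replaced by its inverse.
\<close>

definition submodular :: "'a set \<Rightarrow> bool" where
  "submodular T \<longleftrightarrow> T \<subseteq> carrier S \<and> (\<forall>x\<in>T. x\<^sup>\<star> \<in> T) \<and>
    (\<forall>x\<in>T. \<forall>y\<in>T. x \<squnion>\<^sub>U y \<in> T \<or> x\<^sup>\<star> \<squnion>\<^sub>U y\<^sup>\<star> \<in> T)"

lemma submodular_carrier:
  assumes "structurally_submodular S U"
  shows "submodular (carrier S)"
proof -
  have meet: "x\<^sup>\<star> \<squnion>\<^sub>U y\<^sup>\<star> \<in> carrier S"
    if "x \<in> carrier S" "y \<in> carrier S" "x \<sqinter>\<^bsub>U\<^esub> y \<in> carrier S" for x y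
  proof -
    have "x \<sqinter>\<^bsub>U\<^esub> y = sinv U (x\<^sup>\<star> \<squnion>\<^sub>U y\<^sup>\<star>)" using meet_inv[of "x\<^sup>\<star>" "y\<^sup>\<star>"] that by simp
    moreover have "x\<^sup>\<star> \<squnion>\<^sub>U y\<^sup>\<star> \<in> carrier U" using that in_U by auto
    ultimately have "sinv U (x \<sqinter>\<^bsub>U\<^esub> y) = x\<^sup>\<star> \<squnion>\<^sub>U y\<^sup>\<star>" using U.sinv_sinv by simp
    then show ?thesis using that(3) inv_U inv_in by metis
  qed
  show ?thesis unfolding submodular_def
  proof (intro conjI ballI)
    fix x y assume xy: "x \<in> carrier S" "y \<in> carrier S"
    then have "x \<squnion>\<^sub>U y \<in> carrier S \<or> x \<sqinter>\<^bsub>U\<^esub> y \<in> carrier S"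
      using assms by (simp add: structurally_submodular_def)
    then show "x \<squnion>\<^sub>U y \<in> carrier S \<or> x\<^sup>\<star> \<squnion>\<^sub>U y\<^sup>\<star> \<in> carrier S" using meet[OF xy] by (elim disjE) simp_all
  qed simp_all
qed

end

lemma profile_in: "\<lbrakk>profile S U P; x \<in> P\<rbrakk> \<Longrightarrow> x \<in> carrier S"
  by (auto simp: profile_def orientation_def)

lemma profile_ex: "\<lbrakk>profile S U P; x \<in> carrier S; x \<notin> P\<rbrakk> \<Longrightarrow> x\<^sup>\<star> \<in> P"
  by (auto simp: profile_def orientation_def unoriented_def underlying_def)

lemma profile_unique:
  assumes "profile S U P" "x \<in> carrier S" "x \<in> P" "x\<^sup>\<star> \<in> P"
  shows "x\<^sup>\<star> = x"
proof -
  have "\<exists>!y. y \<in> {x, x\<^sup>\<star>} \<and> y \<in> P"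
    using assms(1,2) by (simp add: profile_def orientation_def unoriented_def underlying_def)
  then show ?thesis using assms(3,4) by blast
qed

text \<open>
  Consistency makes a profile closed downwards, up to one exception: a profile may contain some
  \<open>y\<close> strictly above \<open>y\<^sup>*\<close>, and it then does not contain \<open>y\<^sup>*\<close>.
\<close>

lemma profile_down:
  assumes P: "profile S U P" and "x \<in> carrier S" "y \<in> P" "x \<preceq> y" "x \<notin> P"
  shows "y = x\<^sup>\<star>"
proof -
  have "x\<^sup>\<star> \<in> P" using profile_ex[OF P] assms by blast
  then have "underlying S (x\<^sup>\<star>) = underlying S y"
    using P assms(2-4) unfolding profile_def consistent_def by (metis inv_inv)
  then show ?thesis using assms by (auto simp: underlying_def)
qed

text \<open>
  The exceptional case cannot arise when some profile contains both \<open>x\<close> and \<open>y\<close>, since \<open>y\<close> is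
  then not the inverse of \<open>x\<close> unless the two are equal. This form suffices whenever a new
  separation arises as a corner of two separations in one profile.
\<close>

lemma profile_down_witness:
  assumes P: "profile S U P" and Q: "profile S U Q"
    and "x \<preceq> y" "x \<in> P" "y \<in> P" "y \<in> Q"
  shows "x \<in> Q"
proof (rule ccontr)
  assume "x \<notin> Q"
  have x: "x \<in> carrier S" using profile_in[OF P] assms(4) .
  have "y = x\<^sup>\<star>" using profile_down[OF Q x] assms \<open>x \<notin> Q\<close> by blast
  then have "y = x" using profile_unique[OF P x] assms by blast
  then show False using assms \<open>x \<notin> Q\<close> by blast
qed

lemma profile_join:
  assumes P: "profile S U P" and "x \<in> P" "y \<in> P" "x \<squnion>\<^sub>U y \<in> carrier S"
  shows "x \<squnion>\<^sub>U y \<in> P" and "(x \<squnion>\<^sub>U y)\<^sup>\<star> \<notin> P"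
proof -
  have "x \<in> carrier S" "y \<in> carrier S" using assms profile_in by auto
  then have "x\<^sup>\<star> \<sqinter>\<^bsub>U\<^esub> y\<^sup>\<star> = (x \<squnion>\<^sub>U y)\<^sup>\<star>" using meet_inv inv_U assms by simp
  moreover have "x\<^sup>\<star> \<sqinter>\<^bsub>U\<^esub> y\<^sup>\<star> \<notin> P" using assms(1-3) by (simp add: profile_def)
  ultimately show "(x \<squnion>\<^sub>U y)\<^sup>\<star> \<notin> P" by simp
  then show "x \<squnion>\<^sub>U y \<in> P" using assms profile_ex by blast
qed

lemma profile_join_witness:
  assumes "profile S U P" "profile S U Q" "x \<in> P" "y \<in> P" "x \<squnion>\<^sub>U y \<in> carrier S"
    "x \<squnion>\<^sub>U y \<in> Q"
  shows "x \<in> Q" "y \<in> Q"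
proof -
  have c: "x \<in> carrier S" "y \<in> carrier S" using assms profile_in by blast+
  have "x \<squnion>\<^sub>U y \<in> P" using profile_join(1) assms by blast
  then show "x \<in> Q" "y \<in> Q"
    using profile_down_witness[OF assms(1,2)] le_join1[OF c] le_join2[OF c] assms by blast+
qed

lemma splits_inv:
  assumes "profile S U P" "profile S U Q" "s \<in> carrier S" "splits s P Q"
  shows "splits (s\<^sup>\<star>) P Q"
proof -
  have "s\<^sup>\<star> \<in> R'" "s\<^sup>\<star> \<notin> R"
    if "s \<in> R" "s \<notin> R'" "profile S U R" "profile S U R'" for R R'
    using that assms(3) profile_ex[of R' s] profile_unique[of R s] by force+
  then show ?thesis using assms by (meson splits_def)
qed

text \<open>
  Within a profile that contains \<open>r\<close>, the join with \<open>r\<close> behaves like the separation itself.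
\<close>

lemma splits_join:
  assumes P: "profile S U P" and Q: "profile S U Q" and "splits s P Q" "r \<in> P" "r \<in> Q"
    "s \<squnion>\<^sub>U r \<in> carrier S"
  shows "splits (s \<squnion>\<^sub>U r) P Q"
  using assms profile_join(1)[of P s r] profile_join(1)[of Q s r]
    profile_join_witness[OF P Q, of s r] profile_join_witness[OF Q P, of s r]
  unfolding splits_def by blast

end

locale profiles_in_subsystem = system_in_universe +
  fixes T \<P>
  assumes T: "submodular T" and \<P>: "P \<in> \<P> \<Longrightarrow> profile S U P"
begin

lemma T_in: "x \<in> T \<Longrightarrow> x \<in> carrier S" and T_inv: "x \<in> T \<Longrightarrow> x\<^sup>\<star> \<in> T"
  and T_sub: "x \<in> T \<Longrightarrow> y \<in> T \<Longrightarrow> x \<squnion>\<^sub>U y \<in> T \<or> x\<^sup>\<star> \<squnion>\<^sub>U y\<^sup>\<star> \<in> T"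
proof -
  have "T \<subseteq> carrier S" "\<forall>x\<in>T. x\<^sup>\<star> \<in> T"
    and sub: "\<forall>x\<in>T. \<forall>y\<in>T. x \<squnion>\<^sub>U y \<in> T \<or> x\<^sup>\<star> \<squnion>\<^sub>U y\<^sup>\<star> \<in> T"
    using T by (simp_all add: submodular_def)
  then show "x \<in> T \<Longrightarrow> x \<in> carrier S" "x \<in> T \<Longrightarrow> x\<^sup>\<star> \<in> T" by blast+
  show "x \<in> T \<Longrightarrow> y \<in> T \<Longrightarrow> x \<squnion>\<^sub>U y \<in> T \<or> x\<^sup>\<star> \<squnion>\<^sub>U y\<^sup>\<star> \<in> T"
    by (rule bspec[OF bspec[OF sub]])
qed

lemma exclusive_iff:
  "x \<in> exclusive T \<P> P \<longleftrightarrow> x \<in> T \<and> P \<in> \<P> \<and> x \<in> P \<and> (\<forall>Q\<in>\<P>. Q \<noteq> P \<longrightarrow> x \<notin> Q)"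
  by (auto simp: exclusive_def)

lemma exclusiveD:
  assumes "x \<in> exclusive T \<P> P"
  shows "x \<in> T" "P \<in> \<P>" "x \<in> P" "\<lbrakk>Q \<in> \<P>; Q \<noteq> P\<rbrakk> \<Longrightarrow> x \<notin> Q"
  using assms by (auto simp: exclusive_iff)

lemma exclusive_in: "x \<in> exclusive T \<P> P \<Longrightarrow> x \<in> carrier S"
  by (auto simp: exclusive_iff T_in)

text \<open>
  Growing within \<open>P\<close> keeps a separation out of all other profiles, because these are closed
  downwards.
\<close>

lemma exclusive_up:
  assumes x: "x \<in> exclusive T \<P> P" and "y \<in> T" "y \<in> P" "x \<preceq> y"
  shows "y \<in> exclusive T \<P> P"
proof -
  note P = exclusiveD[OF x]
  have "y \<notin> Q" if "Q \<in> \<P>" "Q \<noteq> P" for Q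
    using P(4)[OF that] profile_down_witness[OF \<P>[OF P(2)] \<P>[OF that(1)] assms(4) P(3) assms(3)]
    by blast
  then show ?thesis using assms P(2) by (simp add: exclusive_iff)
qed

text \<open>
  If the join of \<open>x\<close> and \<open>r\<close> is in \<open>T\<close>, then it is exclusive for \<open>P\<close>, and maximality gives
  \<open>x \<le> r\<close>. Otherwise submodularity puts the meet into \<open>T\<close>. In \<open>shrink_below\<close> this is applied to
  separations \<open>x\<close> that are not exclusive.
\<close>

lemma meet_max_exclusive:
  assumes x: "x \<in> T" "x \<in> P" and r: "r \<in> max_exclusive S T \<P> P"
  shows "x \<preceq> r \<or> x\<^sup>\<star> \<squnion>\<^sub>U r\<^sup>\<star> \<in> T \<and> (x\<^sup>\<star> \<squnion>\<^sub>U r\<^sup>\<star>)\<^sup>\<star> \<in> P"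
proof -
  have r': "r \<in> exclusive T \<P> P" using r by (simp add: max_exclusive_def)
  have PP: "profile S U P" and rP: "r \<in> P" "r \<in> T" 
    using exclusiveD[OF r'] \<P> by blast+
  have c: "x \<in> carrier S" "r \<in> carrier S" using x rP T_in by auto
  show ?thesis
  proof (cases "x \<squnion>\<^sub>U r \<in> T")
    case True
    note j = T_in[OF True]
    have "x \<squnion>\<^sub>U r \<in> P" using profile_join(1)[OF PP] x rP j by blast
    then have "x \<squnion>\<^sub>U r \<in> exclusive T \<P> P"
      using exclusive_up[OF r' True] le_join2 c j by blast
    then have "x \<squnion>\<^sub>U r = r" using r le_join2[OF c j] by (auto simp: max_exclusive_def)
    then show ?thesis using le_join1[OF c j] by simp
  next
    case False
    then have j: "x\<^sup>\<star> \<squnion>\<^sub>U r\<^sup>\<star> \<in> T" using T_sub x rP by blast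
    define d where "d = (x\<^sup>\<star> \<squnion>\<^sub>U r\<^sup>\<star>)\<^sup>\<star>"
    have dc: "d \<in> carrier S" using T_in[OF T_inv[OF j]] by (simp add: d_def)
    have d: "d \<preceq> x" "d \<preceq> r"
      using le_join1[of "x\<^sup>\<star>" "r\<^sup>\<star>"] le_join2[of "x\<^sup>\<star>" "r\<^sup>\<star>"] c T_in[OF j] inv_le_swap
      unfolding d_def by (metis inv_in)+
    (* Were the meet not in P, its inverse would be both x and r. *)
    have "x = r" if "d \<notin> P" using profile_down[OF PP dc] d x rP that by auto
    then show ?thesis using j c by (auto simp: d_def)
  qed
qed

text \<open>
  Every other profile contains both inverses, and then the profile property excludes the meet.
\<close>

lemma meet_exclusive:
  assumes x: "x \<in> exclusive T \<P> P" and r: "r \<in> exclusive T \<P> P"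
    and j: "x\<^sup>\<star> \<squnion>\<^sub>U r\<^sup>\<star> \<in> T" and d: "(x\<^sup>\<star> \<squnion>\<^sub>U r\<^sup>\<star>)\<^sup>\<star> \<in> P"
  shows "(x\<^sup>\<star> \<squnion>\<^sub>U r\<^sup>\<star>)\<^sup>\<star> \<in> exclusive T \<P> P"
proof -
  have "(x\<^sup>\<star> \<squnion>\<^sub>U r\<^sup>\<star>)\<^sup>\<star> \<notin> Q" if Q: "Q \<in> \<P>" "Q \<noteq> P" for Q
  proof -
    have "x \<notin> Q" "r \<notin> Q" using exclusiveD(4)[OF x Q(1)] exclusiveD(4)[OF r Q(1)] Q(2) by blast+
    then have "x\<^sup>\<star> \<in> Q" "r\<^sup>\<star> \<in> Q"
      using profile_ex[OF \<P>[OF Q(1)]] exclusive_in[OF x] exclusive_in[OF r] by blast+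
    then show ?thesis using profile_join(2)[OF \<P>[OF Q(1)]] T_in[OF j] by blast
  qed
  then show ?thesis using exclusiveD(2)[OF x] T_inv[OF j] d unfolding exclusive_iff by blast
qed

text \<open>
  Here \<open>r\<close> and \<open>s\<^sup>*\<close> lie in \<open>P\<close>, while \<open>s\<close> and \<open>r\<^sup>*\<close> lie in \<open>Q\<close>. Submodularity applied to \<open>r\<close> and
  \<open>s\<^sup>*\<close> yields their join, which enlarges \<open>r\<close> in \<open>P\<close>, or the inverse of their meet, which enlarges
  \<open>s\<close> in \<open>Q\<close>. Neither enlargement can be proper.
\<close>

lemma max_exclusive_disjoint:
  assumes r: "r \<in> max_exclusive S T \<P> P" and s: "s \<in> max_exclusive S T \<P> Q" and "P \<noteq> Q"
  shows "r\<^sup>\<star> \<preceq> s"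
proof -
  have re: "r \<in> exclusive T \<P> P" and se: "s \<in> exclusive T \<P> Q"
    using r s by (auto simp: max_exclusive_def)
  have PQ: "profile S U P" "profile S U Q"
    using exclusiveD(2)[OF re] exclusiveD(2)[OF se] \<P> by blast+
  have c: "r \<in> carrier S" "s \<in> carrier S" using re se exclusive_in by blast+
  have rs: "r \<in> P" "s \<in> Q" "r \<in> T" "s \<in> T" using exclusiveD[OF re] exclusiveD[OF se] by blast+
  have "s \<notin> P" "r \<notin> Q"
    using exclusiveD(4)[OF se exclusiveD(2)[OF re]] exclusiveD(4)[OF re exclusiveD(2)[OF se]]
      \<open>P \<noteq> Q\<close> by blast+
  then have m: "s\<^sup>\<star> \<in> P" "r\<^sup>\<star> \<in> Q" using profile_ex PQ c by blast+
  have below: "y\<^sup>\<star> \<preceq> x"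
    if x: "x \<in> max_exclusive S T \<P> P'" and "x \<in> P'" "y\<^sup>\<star> \<in> P'" "profile S U P'"
      "x \<squnion>\<^sub>U y\<^sup>\<star> \<in> T" "y \<in> carrier S" for x y P'
  proof -
    have xe: "x \<in> exclusive T \<P> P'" using x by (auto simp: max_exclusive_def)
    have c: "x \<in> carrier S" "y\<^sup>\<star> \<in> carrier S" "x \<squnion>\<^sub>U y\<^sup>\<star> \<in> carrier S"
      using that T_in exclusive_in[OF xe] by auto
    have "x \<squnion>\<^sub>U y\<^sup>\<star> \<in> P'" using that profile_join(1) c by blast
    then have "x \<squnion>\<^sub>U y\<^sup>\<star> \<in> exclusive T \<P> P'" using exclusive_up[OF xe] le_join1 c that by blast
    then have "x \<squnion>\<^sub>U y\<^sup>\<star> = x" using x le_join1[OF c] by (auto simp: max_exclusive_def)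
    then show ?thesis using le_join2[OF c] by simp
  qed
  have "r \<squnion>\<^sub>U s\<^sup>\<star> \<in> T \<or> s \<squnion>\<^sub>U r\<^sup>\<star> \<in> T"
    using T_sub[OF rs(3) T_inv[OF rs(4)]] c join_comm[of U s "r\<^sup>\<star>"] by simp
  then show ?thesis
    using below[OF r, of s] below[OF s, of r] m rs PQ c inv_le_swap[of s r] by blast
qed

end

locale finite_profiles_in_subsystem = profiles_in_subsystem +
  assumes fin: "finite (carrier S)"
begin

lemma max_exclusive_above:
  assumes "x \<in> exclusive T \<P> P"
  shows "\<exists>r\<in>max_exclusive S T \<P> P. x \<preceq> r"
proof -
  let ?A = "{y\<in>exclusive T \<P> P. x \<preceq> y}" and ?f = "\<lambda>y. card {z\<in>carrier S. z \<preceq> y}"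
  have "finite ?A" using fin exclusive_in by (auto intro: finite_subset[of _ "carrier S"])
  moreover have "x \<in> ?A" using assms exclusive_in by auto
  ultimately obtain r where r: "r \<in> ?A" and max: "\<And>y. y \<in> ?A \<Longrightarrow> ?f y \<le> ?f r"
    using Max_ge[of "?f ` ?A"] Max_in[of "?f ` ?A"] by fastforce
  have "y = r" if y: "y \<in> exclusive T \<P> P" "r \<preceq> y" for y
  proof (rule ccontr)
    assume "y \<noteq> r"
    have c: "x \<in> carrier S" "y \<in> carrier S" "r \<in> carrier S" using y r assms exclusive_in by auto
    have "x \<preceq> y" using r y le_trans c by blast
    then have "?f y \<le> ?f r" using max y by blast
    moreover have "{z\<in>carrier S. z \<preceq> r} \<subset> {z\<in>carrier S. z \<preceq> y}"
    proof (intro psubsetI subsetI)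
      show "z \<in> {z\<in>carrier S. z \<preceq> y}" if "z \<in> {z\<in>carrier S. z \<preceq> r}" for z
        using that y(2) c le_trans by blast
      have "\<not> y \<preceq> r" using \<open>y \<noteq> r\<close> y(2) c le_antisym by blast
      then show "{z\<in>carrier S. z \<preceq> r} \<noteq> {z\<in>carrier S. z \<preceq> y}" using c le_refl by blast
    qed
    then have "?f r < ?f y" using fin by (simp add: psubset_card_mono)
    ultimately show False by simp
  qed
  then show ?thesis using r by (auto simp: max_exclusive_def)
qed

text \<open>
  The infimum is formed by taking in the maximal exclusive separations one at a time. All partial
  infima stay exclusive, so \<open>meet_max_exclusive\<close> and \<open>meet_exclusive\<close> apply at every step.
\<close>

lemma leaf_exists:
  assumes "exclusive T \<P> P \<noteq> {}"
  shows "leaf S T \<P> P \<noteq> {}"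
proof -
  let ?E = "exclusive T \<P> P" and ?M = "max_exclusive S T \<P> P"
  have M: "?M \<noteq> {}" "?M \<subseteq> ?E" using assms max_exclusive_above by (auto simp: max_exclusive_def)
  then have finM: "finite ?M" using fin exclusive_in by (meson finite_subset subsetI)
  have "A \<subseteq> ?M \<longrightarrow> (\<exists>m\<in>?E. (\<forall>r\<in>A. m \<preceq> r) \<and>
      (\<forall>x\<in>T. (\<forall>r\<in>A. x \<preceq> r) \<longrightarrow> x \<preceq> m))" if "finite A" "A \<noteq> {}" for A
    using that
  proof (induction A rule: finite_ne_induct)
    case (singleton r)
    then show ?case using M exclusive_in by (auto intro!: bexI[of _ r])
  next
    case (insert r A)
    show ?case
    proof
      assume A: "insert r A \<subseteq> ?M"
      then have "A \<subseteq> ?M" by simp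
      then obtain m where m: "m \<in> ?E" "\<forall>r\<in>A. m \<preceq> r"
        and gr: "\<forall>x\<in>T. (\<forall>r\<in>A. x \<preceq> r) \<longrightarrow> x \<preceq> m" using insert.IH by blast
      have c: "m \<in> carrier S" "r \<in> carrier S" using m A M exclusive_in by auto
      have cA: "y \<in> carrier S" if "y \<in> A" for y using that A M exclusive_in by blast
      show "\<exists>m\<in>?E. (\<forall>r\<in>insert r A. m \<preceq> r) \<and> (\<forall>x\<in>T. (\<forall>r\<in>insert r A. x \<preceq> r) \<longrightarrow> x \<preceq> m)"
      proof (cases "m \<preceq> r")
        case True
        then show ?thesis using m gr by (intro bexI[of _ m]) auto
      next
        case False
        define d where "d = (m\<^sup>\<star> \<squnion>\<^sub>U r\<^sup>\<star>)\<^sup>\<star>"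
        have j': "m\<^sup>\<star> \<squnion>\<^sub>U r\<^sup>\<star> \<in> T" and "d \<in> P"
          using meet_max_exclusive[of m P r] m(1) A False by (auto simp: d_def exclusive_iff)
        then have d: "d \<in> ?E" using meet_exclusive[OF m(1)] A M by (auto simp: d_def)
        have j: "m\<^sup>\<star> \<squnion>\<^sub>U r\<^sup>\<star> \<in> carrier S" using j' T_in by blast
        have dc: "d \<in> carrier S" using d exclusive_in by blast
        have le: "d \<preceq> m" "d \<preceq> r"
          using le_join1[of "m\<^sup>\<star>" "r\<^sup>\<star>"] le_join2[of "m\<^sup>\<star>" "r\<^sup>\<star>"] c j inv_le_swap unfolding d_def
          by (metis inv_in)+
        have "d \<preceq> y" if "y \<in> A" for y using le_trans[OF le(1) bspec[OF m(2) that] dc c(1) cA[OF that]] .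
        moreover have "x \<preceq> d" if x: "x \<in> T" "\<forall>y\<in>insert r A. x \<preceq> y" for x
        proof -
          have xc: "x \<in> carrier S" using x T_in by blast
          have "x \<preceq> m" "x \<preceq> r" using x gr by auto
          then have "m\<^sup>\<star> \<squnion>\<^sub>U r\<^sup>\<star> \<preceq> x\<^sup>\<star>" using join_le j c xc inv_le by simp
          then show ?thesis using inv_le[of "x\<^sup>\<star>"] j xc by (simp add: d_def)
        qed
        ultimately show ?thesis using d le by (intro bexI[of _ d]) auto
      qed
    qed
  qed
  from this[OF finM M(1)] show ?thesis unfolding leaf_def by blast
qed

lemma leafD:
  assumes "m \<in> leaf S T \<P> P"
  shows "m \<in> exclusive T \<P> P" "r \<in> max_exclusive S T \<P> P \<Longrightarrow> m \<preceq> r"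
    "\<lbrakk>x \<in> T; \<And>r. r \<in> max_exclusive S T \<P> P \<Longrightarrow> x \<preceq> r\<rbrakk> \<Longrightarrow> x \<preceq> m"
  using assms unfolding leaf_def by blast+

lemma leaf_in: "m \<in> leaf S T \<P> P \<Longrightarrow> m \<in> T"
  using leafD(1) exclusiveD(1) by blast

lemma leaf_unique:
  assumes "m \<in> leaf S T \<P> P" "m' \<in> leaf S T \<P> P"
  shows "m = m'"
proof (rule le_antisym)
  show "m \<preceq> m'" using leafD(3)[OF assms(2)] leafD(2)[OF assms(1)] leaf_in[OF assms(1)] by blast
  show "m' \<preceq> m" using leafD(3)[OF assms(1)] leafD(2)[OF assms(2)] leaf_in[OF assms(2)] by blast
qed (use leaf_in T_in assms in blast)+

text \<open>
  The inverse of \<open>s\<close> is a lower bound in \<open>T\<close> of the maximal exclusive separations of \<open>P\<close>, and the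
  leaf is the greatest one. For this the leaf has to dominate all lower bounds in \<open>T\<close>, not just the
  exclusive ones.
\<close>

lemma leaf_max_disjoint:
  assumes m: "m \<in> leaf S T \<P> P" and s: "s \<in> max_exclusive S T \<P> Q" and "P \<noteq> Q"
  shows "m\<^sup>\<star> \<preceq> s"
proof -
  have sT: "s \<in> T" using s by (simp add: max_exclusive_def exclusive_iff)
  have "s\<^sup>\<star> \<preceq> r" if "r \<in> max_exclusive S T \<P> P" for r
    using max_exclusive_disjoint[OF s that] assms by blast
  then have "s\<^sup>\<star> \<preceq> m" by (rule leafD(3)[OF m T_inv[OF sT]])
  then show ?thesis using inv_le_swap T_in sT leaf_in[OF m] by blast
qed

lemma leaf_disjoint:
  assumes m: "m \<in> leaf S T \<P> P" and m': "m' \<in> leaf S T \<P> Q" and "P \<noteq> Q"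
  shows "m\<^sup>\<star> \<preceq> m'"
  using leafD(3)[OF m' T_inv[OF leaf_in[OF m]]] leaf_max_disjoint[OF m _ \<open>P \<noteq> Q\<close>] by blast

lemma points_to_inv: "s \<in> carrier S \<Longrightarrow> points_to S (s\<^sup>\<star>) m \<longleftrightarrow> points_to S s m"
  by (auto simp: points_to_def)

lemma points_to_join:
  assumes "points_to S x m" "points_to S y m"
    and c: "x \<in> carrier S" "y \<in> carrier S" "m \<in> carrier S" "x \<squnion>\<^sub>U y \<in> carrier S"
  shows "points_to S (x \<squnion>\<^sub>U y) m"
proof -
  consider "m\<^sup>\<star> \<preceq> x" | "m\<^sup>\<star> \<preceq> y" | "x \<preceq> m" "y \<preceq> m"
    using assms inv_le by (auto simp: points_to_def)
  then show ?thesis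
  proof cases
    case 1
    have "m\<^sup>\<star> \<preceq> x \<squnion>\<^sub>U y" by (rule le_trans[OF 1]) (use c le_join1 in auto)
    then show ?thesis by (simp add: points_to_def)
  next
    case 2
    have "m\<^sup>\<star> \<preceq> x \<squnion>\<^sub>U y" by (rule le_trans[OF 2]) (use c le_join2 in auto)
    then show ?thesis by (simp add: points_to_def)
  next
    case 3
    then have "m\<^sup>\<star> \<preceq> (x \<squnion>\<^sub>U y)\<^sup>\<star>" using c join_le inv_le by simp
    then show ?thesis by (simp add: points_to_def)
  qed
qed

end

locale separated_profiles = finite_profiles_in_subsystem +
  assumes separated: "\<lbrakk>P \<in> \<P>; Q \<in> \<P>; P \<noteq> Q\<rbrakk> \<Longrightarrow> \<exists>t\<in>T. splits t P Q"
begin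

lemma separated_oriented:
  assumes "P \<in> \<P>" "Q \<in> \<P>" "P \<noteq> Q"
  shows "\<exists>t\<in>T. t \<in> P \<and> t \<notin> Q"
proof -
  obtain t where t: "t \<in> T" "splits t P Q" using separated assms by blast
  then have "splits (t\<^sup>\<star>) P Q" using splits_inv \<P> assms T_in by blast
  moreover have "t \<in> P \<or> t\<^sup>\<star> \<in> P" using profile_ex \<P> assms T_in t by blast
  ultimately show ?thesis using t T_inv by (auto simp: splits_def)
qed

section \<open>Existence of exclusive separations\<close>

text \<open>
  Adding \<open>Q\<close> to \<open>\<Q>\<close> may spoil the exclusiveness of \<open>x\<close>. Joining with \<open>y\<^sup>*\<close> repairs this: it stays
  within \<open>R\<close>, which does not contain \<open>y\<close>, and it leaves \<open>Q\<close>, which does.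
\<close>

lemma exclusive_extend:
  assumes x: "x \<in> exclusive T \<Q> R" and y: "y \<in> exclusive T \<Q> R'" and "R \<noteq> R'"
    and Q: "insert Q \<Q> \<subseteq> \<P>" and "y \<in> Q" and j: "x \<squnion>\<^sub>U y\<^sup>\<star> \<in> T"
  shows "x \<squnion>\<^sub>U y\<^sup>\<star> \<in> exclusive T (insert Q \<Q>) R"
proof -
  interpret Q: profiles_in_subsystem S U T \<Q>
    by unfold_locales (use T \<P> Q in auto)
  have R: "R \<in> \<Q>" "x \<in> R" "y \<notin> R" "x \<in> T" "y \<in> T" and onlyR: "\<And>Z. Z \<in> \<Q> \<Longrightarrow> Z \<noteq> R \<Longrightarrow> x \<notin> Z"
    using x y \<open>R \<noteq> R'\<close> by (auto simp: Q.exclusive_iff)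
  have PR: "profile S U R" and PQ: "profile S U Q" using R Q \<P> by auto
  have yR: "y\<^sup>\<star> \<in> R" using profile_ex[OF PR] T_in R by blast
  have jR: "x \<squnion>\<^sub>U y\<^sup>\<star> \<in> R" using profile_join(1)[OF PR] R yR T_in[OF j] by blast
  have w: "x \<in> Z" "y\<^sup>\<star> \<in> Z" if "Z \<in> \<P>" "x \<squnion>\<^sub>U y\<^sup>\<star> \<in> Z" for Z
    using profile_join_witness[OF PR \<P>[OF that(1)] R(2) yR T_in[OF j] that(2)] by auto
  have "y\<^sup>\<star> \<notin> Q" using profile_unique[OF PQ T_in[OF R(5)]] \<open>y \<in> Q\<close> yR R(3) by auto
  then have "x \<squnion>\<^sub>U y\<^sup>\<star> \<notin> Z" if "Z \<in> insert Q \<Q>" "Z \<noteq> R" for Z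
    using w[of Z] that onlyR[of Z] Q by blast
  then show ?thesis using j jR R by (auto simp: exclusive_def)
qed

text \<open>
  The induction needs the strong form, which yields an exclusive separation for a profile other
  than a prescribed one. Applied twice to \<open>\<Q>\<close> itself, it gives two profiles of \<open>\<Q>\<close> with
  separations \<open>x\<close> and \<open>y\<close> exclusive within \<open>\<Q>\<close>. One that is not in \<open>Q\<close> remains exclusive; if \<open>Q\<close>
  contains both, then submodularity provides \<open>x \<squnion> y\<^sup>*\<close> or \<open>y \<squnion> x\<^sup>*\<close>.
\<close>

lemma exclusive_exists_other:
  assumes "finite \<Q>" "\<Q> \<noteq> {}" "insert Q \<Q> \<subseteq> \<P>" "Q \<notin> \<Q>"
  shows "\<exists>R\<in>\<Q>. exclusive T (insert Q \<Q>) R \<noteq> {}"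
  using assms
proof (induction \<Q> arbitrary: Q rule: finite_psubset_induct)
  case (psubset \<Q>)
  have other: "\<exists>R\<in>\<Q>. R \<noteq> R0 \<and> exclusive T \<Q> R \<noteq> {}" if "R0 \<in> \<Q>" "\<Q> \<noteq> {R0}" for R0
  proof -
    have "insert R0 (\<Q> - {R0}) = \<Q>" using that by auto
    moreover have "\<Q> - {R0} \<subset> \<Q>" "\<Q> - {R0} \<noteq> {}" using that by auto
    ultimately show ?thesis using psubset.IH[of "\<Q> - {R0}" R0] psubset.prems by auto
  qed
  obtain R0 where R0: "R0 \<in> \<Q>" using psubset.prems by blast
  show ?case
  proof (cases "\<Q> = {R0}")
    case True
    then have "\<exists>t\<in>T. t \<in> R0 \<and> t \<notin> Q" using separated_oriented[of R0 Q] psubset.prems by auto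
    then have "exclusive T (insert Q \<Q>) R0 \<noteq> {}" using True by (auto simp: exclusive_def)
    then show ?thesis using R0 by blast
  next
    case False
    then obtain R1 x where R1: "R1 \<in> \<Q>" "x \<in> exclusive T \<Q> R1" using other R0 by blast
    have "\<Q> \<noteq> {R1}" using False R0 by auto
    then obtain R2 y where R2: "R2 \<in> \<Q>" "R2 \<noteq> R1" "y \<in> exclusive T \<Q> R2" using other R1 by blast
    have T: "x \<in> T" "y \<in> T" using R1 R2 by (auto simp: exclusive_def)
    consider "x \<notin> Q" | "y \<notin> Q" | "x \<in> Q" "y \<in> Q" by blast
    then show ?thesis
    proof cases
      case 1
      then have "x \<in> exclusive T (insert Q \<Q>) R1" using R1 by (auto simp: exclusive_def)
      then show ?thesis using R1 by blast
    next
      case 2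
      then have "y \<in> exclusive T (insert Q \<Q>) R2" using R2 by (auto simp: exclusive_def)
      then show ?thesis using R2 by blast
    next
      case 3
      have "x \<squnion>\<^sub>U y\<^sup>\<star> \<in> T \<or> y \<squnion>\<^sub>U x\<^sup>\<star> \<in> T"
        using T_sub[of x "y\<^sup>\<star>"] T T_inv T_in join_comm[of U] by simp
      then show ?thesis
        using exclusive_extend[OF R1(2) R2(3) _ psubset.prems(2) 3(2)]
          exclusive_extend[OF R2(3) R1(2) _ psubset.prems(2) 3(1)] R1 R2 by blast
    qed
  qed
qed

lemma finite_profiles: "finite \<P>"
proof (rule finite_subset)
  show "\<P> \<subseteq> Pow (carrier S)" using \<P> profile_in by blast
qed (simp add: fin)

lemma exclusive_exists:
  assumes "P \<in> \<P>" "Q \<in> \<P>" "P \<noteq> Q"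
  shows "\<exists>R\<in>\<P>. exclusive T \<P> R \<noteq> {}"
proof -
  have "insert Q (\<P> - {Q}) = \<P>" using assms by auto
  moreover have "finite (\<P> - {Q})" "\<P> - {Q} \<noteq> {}" "Q \<notin> \<P> - {Q}"
    using finite_profiles assms by auto
  ultimately show ?thesis using exclusive_exists_other[of "\<P> - {Q}" Q] by force
qed

section \<open>Passing to the separations that point to all leaves\<close>

text \<open>
  A separation of \<open>R\<close> that splits \<open>P\<close> and \<open>Q\<close> is met successively with the maximal exclusive
  separations of \<open>R\<close>. Each meet stays in \<open>R\<close> and still splits, because \<open>P\<close> and \<open>Q\<close> both contain the
  inverse of the separation that it is met with. It also keeps pointing to the leaves in \<open>L\<close> of
  other profiles, because the maximal exclusive separations of \<open>R\<close> lie above the inverses of these.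
\<close>

lemma shrink_below:
  assumes P: "P \<in> \<P>" "P \<noteq> R" and Q: "Q \<in> \<P>" "Q \<noteq> R" and R: "R \<in> \<P>"
    and s: "s \<in> T" "splits s P Q" "s \<in> R"
    and L: "\<And>m. m \<in> L \<Longrightarrow> points_to S s m \<and> (\<exists>R'. R' \<noteq> R \<and> m \<in> leaf S T \<P> R')"
    and "finite A" "A \<subseteq> max_exclusive S T \<P> R"
  shows "\<exists>s'\<in>T. splits s' P Q \<and> s' \<in> R \<and> (\<forall>m\<in>L. points_to S s' m) \<and> (\<forall>r\<in>A. s' \<preceq> r)"
  using \<open>finite A\<close> \<open>A \<subseteq> _\<close>
proof (induction A rule: finite_induct)
  case empty
  then show ?case using s L by auto
next
  case (insert r A)
  then obtain s' where s': "s' \<in> T" "splits s' P Q" "s' \<in> R" "\<forall>m\<in>L. points_to S s' m"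
    "\<forall>r\<in>A. s' \<preceq> r" by auto
  have r: "r \<in> max_exclusive S T \<P> R" using insert by auto
  then have re: "r \<in> exclusive T \<P> R" by (auto simp: max_exclusive_def)
  have c: "s' \<in> carrier S" "r \<in> carrier S" using s' re T_in exclusive_in by auto
  have PP: "profile S U P" "profile S U Q" using P Q \<P> by auto
  show ?case
  proof (cases "s' \<preceq> r")
    case True
    then show ?thesis using s' by auto
  next
    case False
    define j where "j = s'\<^sup>\<star> \<squnion>\<^sub>U r\<^sup>\<star>"
    have j: "j \<in> T" "j\<^sup>\<star> \<in> R" using meet_max_exclusive[OF s'(1,3) r] False by (auto simp: j_def)
    have jc: "j \<in> carrier S" using j T_in by blast
    have "r \<notin> P" "r \<notin> Q" using re P Q by (auto simp: exclusive_iff)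
    then have "r\<^sup>\<star> \<in> P" "r\<^sup>\<star> \<in> Q" using profile_ex PP c by auto
    then have "splits j P Q"
      unfolding j_def using splits_join PP splits_inv[OF PP c(1) s'(2)] jc j_def by blast
    then have sp: "splits (j\<^sup>\<star>) P Q" using splits_inv PP jc by blast
    have "points_to S (j\<^sup>\<star>) m" if m: "m \<in> L" for m
    proof -
      obtain R' where R': "R' \<noteq> R" "m \<in> leaf S T \<P> R'" using L m by blast
      then have "m\<^sup>\<star> \<preceq> r" using leaf_max_disjoint r by blast
      then have "points_to S (r\<^sup>\<star>) m" using c by (simp add: points_to_def)
      moreover have "points_to S (s'\<^sup>\<star>) m" using s' m c points_to_inv by blast
      ultimately have "points_to S j m"
        unfolding j_def using points_to_join c jc leaf_in[OF R'(2)] T_in j_def by simp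
      then show ?thesis using points_to_inv jc by blast
    qed
    moreover have below: "j\<^sup>\<star> \<preceq> s'" "j\<^sup>\<star> \<preceq> r"
      using le_join1[of "s'\<^sup>\<star>" "r\<^sup>\<star>"] le_join2[of "s'\<^sup>\<star>" "r\<^sup>\<star>"] c jc inv_le_swap
      unfolding j_def by (metis inv_in)+
    moreover have "j\<^sup>\<star> \<preceq> q" if q: "q \<in> A" for q
    proof -
      have "q \<in> carrier S" using q insert exclusive_in by (auto simp: max_exclusive_def)
      then show ?thesis using le_trans[OF below(1), of q] s' q c jc by auto
    qed
    ultimately show ?thesis using sp j T_inv by auto
  qed
qed

text \<open>
  The leaves are treated one discarded profile \<open>R\<close> at a time. Once a separation is below all maximal
  exclusive separations of \<open>R\<close>, it is below the leaf \<open>m\<close> of \<open>R\<close>, so its inverse is above \<open>m\<^sup>*\<close>.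
\<close>

lemma separated_pointing:
  assumes P: "P \<in> \<P>" "exclusive T \<P> P = {}" and Q: "Q \<in> \<P>" "exclusive T \<P> Q = {}"
    and "P \<noteq> Q" and "finite \<R>" "\<R> \<subseteq> {R\<in>\<P>. exclusive T \<P> R \<noteq> {}}"
  shows "\<exists>s\<in>T. splits s P Q \<and> (\<forall>R\<in>\<R>. \<forall>m\<in>leaf S T \<P> R. points_to S s m)"
  using \<open>finite \<R>\<close> \<open>\<R> \<subseteq> _\<close>
proof (induction \<R> rule: finite_induct)
  case empty
  then show ?case using separated assms by auto
next
  case (insert R \<R>)
  then obtain s where s: "s \<in> T" "splits s P Q" "\<forall>R\<in>\<R>. \<forall>m\<in>leaf S T \<P> R. points_to S s m"
    by auto
  have R: "R \<in> \<P>" "P \<noteq> R" "Q \<noteq> R" using insert P Q by auto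
  have sc: "s \<in> carrier S" using s T_in by blast
  define L where "L = (\<Union>R\<in>\<R>. leaf S T \<P> R)"
  obtain t where t: "t \<in> T" "splits t P Q" "t \<in> R" "\<forall>m\<in>L. points_to S t m"
  proof (cases "s \<in> R")
    case True
    then show ?thesis using that s by (auto simp: L_def)
  next
    case False
    then have "s\<^sup>\<star> \<in> R" using profile_ex \<P> R sc by blast
    then show ?thesis
      using that[of "s\<^sup>\<star>"] s sc T_inv splits_inv[of P Q s] \<P> P Q points_to_inv by (auto simp: L_def)
  qed
  have "points_to S t m \<and> (\<exists>R'. R' \<noteq> R \<and> m \<in> leaf S T \<P> R')" if "m \<in> L" for m
    using that t(4) insert.hyps by (auto simp: L_def)
  moreover have "finite (max_exclusive S T \<P> R)"
    using fin exclusive_in by (auto simp: max_exclusive_def intro: finite_subset[of _ "carrier S"])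
  ultimately obtain s' where s': "s' \<in> T" "splits s' P Q" "\<forall>m\<in>L. points_to S s' m"
    "\<forall>r\<in>max_exclusive S T \<P> R. s' \<preceq> r"
    using shrink_below[OF P(1) R(2) Q(1) R(3) R(1) t(1-3), of L "max_exclusive S T \<P> R"] by auto
  have "points_to S s' m" if m: "m \<in> leaf S T \<P> R" for m
  proof -
    have "s' \<preceq> m" using m s' by (auto simp: leaf_def)
    then show ?thesis using inv_le T_in leaf_in[OF m] s'(1) by (simp add: points_to_def)
  qed
  then show ?case using s' by (auto simp: L_def)
qed

lemma leaves_eq: "leaves S (T, \<P>) = (\<Union>R\<in>{R\<in>\<P>. exclusive T \<P> R \<noteq> {}}. leaf S T \<P> R)"
  by (auto simp: leaves_def leaf_def)

lemma submodular_pointing: "submodular (pointing S T (leaves S (T, \<P>)))"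
proof -
  define L where "L = leaves S (T, \<P>)"
  have join: "x \<squnion>\<^sub>U y \<in> pointing S T L"
    if "x \<in> pointing S T L" "y \<in> pointing S T L" "x \<squnion>\<^sub>U y \<in> T" for x y
    using that points_to_join[of x _ y] T_in leaves_in[of _ S T \<P>] by (simp add: pointing_def L_def)
  have inv: "x\<^sup>\<star> \<in> pointing S T L" if "x \<in> pointing S T L" for x
    using that points_to_inv T_in T_inv by (simp add: pointing_def)
  have "pointing S T L \<subseteq> T" by (auto simp: pointing_def)
  then show ?thesis
    unfolding submodular_def L_def[symmetric] using join inv T_in T_sub by (meson subset_iff)
qed

lemma separated_step:
  assumes "step S (T, \<P>) = (T', \<P>')"
  shows "separated_profiles S U T' \<P>'"
proof unfold_locales
  have T': "T' = pointing S T (leaves S (T, \<P>))"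
    and \<P>': "\<P>' = {P\<in>\<P>. exclusive T \<P> P = {}}" using assms by (simp_all add: step_def)
  show "submodular T'" using T' submodular_pointing by simp
  show "profile S U P" if "P \<in> \<P>'" for P using that \<P> \<P>' by simp
  show "\<exists>t\<in>T'. splits t P Q" if "P \<in> \<P>'" "Q \<in> \<P>'" "P \<noteq> Q" for P Q
    using separated_pointing[of P Q "{R\<in>\<P>. exclusive T \<P> R \<noteq> {}}"] that finite_profiles
    unfolding T' \<P>' pointing_def leaves_eq by auto
qed (rule fin)

lemma leaves_nested:
  assumes "m \<in> leaves S (T, \<P>)" "m' \<in> leaves S (T, \<P>)"
  shows "nested S (underlying S m) (underlying S m')"
proof -
  obtain P Q where "m \<in> leaf S T \<P> P" "m' \<in> leaf S T \<P> Q" using assms by (auto simp: leaves_def)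
  then have "m = m' \<or> m\<^sup>\<star> \<preceq> m'" using leaf_unique leaf_disjoint by blast
  moreover have "m \<in> carrier S" using assms leaves_in[of m S T \<P>] T_in by blast
  ultimately show ?thesis by (auto simp: nested_def underlying_def)
qed

end

section \<open>The canonical nested set\<close>

theorem theorem2:
  shows "\<exists>N :: 'a sepsys \<Rightarrow> 'a set set \<Rightarrow> 'a set set.
    \<forall>S U \<P>.
      separation_system S \<and> finite (carrier S) \<and>
      separation_universe U \<and> subsystem S U \<and> structurally_submodular S U \<and>
      (\<forall>P\<in>\<P>. profile S U P) \<longrightarrow>
        N S \<P> \<subseteq> unoriented S \<and> nested_set S (N S \<P>) \<and> distinguishes_set S (N S \<P>) \<P> \<and>
        (\<forall>S' \<phi>. separation_system S' \<and> sepsys_iso S S' \<phi> \<longrightarrow>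
          image \<phi> ` N S \<P> = N S' (image \<phi> ` \<P>))"
proof (intro exI[of _ canonical_tree] allI impI, elim conjE)
  fix S U :: "'a sepsys" and \<P> :: "'a set set"
  assume S: "separation_system S" and fin: "finite (carrier S)" and U: "separation_universe U"
    and sub: "subsystem S U" and subm: "structurally_submodular S U"
    and \<P>: "\<forall>P\<in>\<P>. profile S U P"
  interpret system_in_universe S U using S U sub by (rule system_in_universe.intro)
  define T where "T n = fst (stage S \<P> n)" for n
  define \<Q> where "\<Q> n = snd (stage S \<P> n)" for n
  have stage: "stage S \<P> n = (T n, \<Q> n)" for n by (simp add: T_def \<Q>_def)
  have suc: "step S (T n, \<Q> n) = (T (Suc n), \<Q> (Suc n))" for n
    using stage[of n] stage[of "Suc n"] by (simp add: stage_def)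
  have zero: "T 0 = carrier S" "\<Q> 0 = \<P>" by (simp_all add: T_def \<Q>_def stage_def)
  have separated: "separated_profiles S U (T n) (\<Q> n)" for n
  proof (induction n)
    case 0
    show ?case unfolding zero
    proof unfold_locales
      show "submodular (carrier S)" by (rule submodular_carrier[OF subm])
      show "profile S U P" if "P \<in> \<P>" for P using that \<P> by blast
      show "\<exists>t\<in>carrier S. splits t P Q" if "P \<in> \<P>" "Q \<in> \<P>" "P \<noteq> Q" for P Q
      proof -
        obtain t where t: "(t \<in> P) \<noteq> (t \<in> Q)" using \<open>P \<noteq> Q\<close> by blast
        then have "t \<in> carrier S" using that(1,2) \<P> profile_in by blast
        then show ?thesis using t by (auto simp: splits_def)
      qed
    qed (rule fin)
  next
    case (Suc n)
    then show ?case using suc separated_profiles.separated_step by blast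
  qed
  have L_in: "m \<in> T n" "m \<in> carrier S" if "m \<in> leaves S (T n, \<Q> n)" for m n
  proof -
    interpret separated_profiles S U "T n" "\<Q> n" by (fact separated)
    show "m \<in> T n" "m \<in> carrier S" using that leaves_in[of m S "T n" "\<Q> n"] T_in by blast+
  qed
  have T_suc: "T (Suc n) = pointing S (T n) (leaves S (T n, \<Q> n))"
    and \<Q>_suc: "\<Q> (Suc n) = {P\<in>\<Q> n. exclusive (T n) (\<Q> n) P = {}}" for n
    using suc[of n] by (auto simp: step_def)
  have anti: "T n \<subseteq> T k" if "k \<le> n" for k n
    using that by (induction n rule: dec_induct) (auto simp: T_suc pointing_def)
  have N: "canonical_tree S \<P> = underlying S ` (\<Union>n. leaves S (T n, \<Q> n))"
    by (simp add: canonical_tree_def stage)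
  (* A leaf of a later stage points to all leaves of earlier stages. *)
  have later: "nested S (underlying S m) (underlying S m') \<and>
      nested S (underlying S m') (underlying S m)"
    if "m \<in> leaves S (T k, \<Q> k)" "m' \<in> leaves S (T n, \<Q> n)" "k < n" for m m' k n
  proof -
    have "m' \<in> T (Suc k)" using that anti[of "Suc k" n] L_in by auto
    then have "points_to S m' m" using that by (auto simp: T_suc pointing_def)
    then have "sinv S m \<sqsubseteq>\<^bsub>S\<^esub> m' \<or> sinv S m \<sqsubseteq>\<^bsub>S\<^esub> sinv S m'"
      "sinv S m' \<sqsubseteq>\<^bsub>S\<^esub> m \<or> m' \<sqsubseteq>\<^bsub>S\<^esub> m"
      using inv_le_swap[of m m'] inv_le[of m m'] L_in(2)[OF that(1)] L_in(2)[OF that(2)]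
      by (auto simp: points_to_def)
    then show ?thesis by (auto simp: nested_def underlying_def)
  qed
  have "nested_set S (canonical_tree S \<P>)"
  proof -
    have "nested S (underlying S m) (underlying S m')"
      if m: "m \<in> leaves S (T k, \<Q> k)" "m' \<in> leaves S (T n, \<Q> n)" for m m' k n
    proof (cases k n rule: linorder_cases)
      case equal
      interpret separated_profiles S U "T n" "\<Q> n" by (fact separated)
      show ?thesis using leaves_nested m equal by blast
    qed (use later m in blast)+
    then show ?thesis by (auto simp: nested_set_def N)
  qed
  moreover have "distinguishes_set S (canonical_tree S \<P>) \<P>"
    unfolding distinguishes_set_def
  proof (intro ballI impI)
    fix P Q assume PQ: "P \<in> \<P>" "Q \<in> \<P>" "P \<noteq> Q"
    obtain n where "P \<in> \<Q> n" "Q \<in> \<Q> n" "\<not> (P \<in> \<Q> (Suc n) \<and> Q \<in> \<Q> (Suc n))"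
    proof (rule ccontr)
      (* Otherwise both profiles survive forever, although every stage loses a profile. *)
      assume "\<not> thesis"
      then have keep: "P \<in> \<Q> (Suc n) \<and> Q \<in> \<Q> (Suc n)" if "P \<in> \<Q> n \<and> Q \<in> \<Q> n" for n
        using that \<open>\<And>n. \<lbrakk>P \<in> \<Q> n; Q \<in> \<Q> n; \<not> (P \<in> \<Q> (Suc n) \<and> Q \<in> \<Q> (Suc n))\<rbrakk> \<Longrightarrow> thesis\<close>
        by blast
      have both: "P \<in> \<Q> n \<and> Q \<in> \<Q> n" for n
        by (induction n) (use PQ zero keep in simp_all)
      have less: "card (\<Q> (Suc n)) < card (\<Q> n)" for n
      proof -
        interpret separated_profiles S U "T n" "\<Q> n" by (fact separated)
        obtain R where "R \<in> \<Q> n" "exclusive (T n) (\<Q> n) R \<noteq> {}"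
          using exclusive_exists[of P Q] both PQ(3) by blast
        then have "\<Q> (Suc n) \<subset> \<Q> n" unfolding \<Q>_suc by blast
        then show ?thesis using finite_profiles by (simp add: psubset_card_mono)
      qed
      have "card (\<Q> n) + n \<le> card (\<Q> 0)" for n
      proof (induction n)
        case (Suc n)
        then show ?case using less[of n] by linarith
      qed simp
      from this[of "Suc (card (\<Q> 0))"] show False by simp
    qed
    note n = this
    interpret separated_profiles S U "T n" "\<Q> n" by (fact separated)
    have leaf_separates: "m \<in> R \<and> sinv S m \<in> R' \<and> underlying S m \<in> canonical_tree S \<P>"
      if m: "m \<in> leaf S (T n) (\<Q> n) R" and "R' \<in> \<Q> n" "R' \<noteq> R" for m R R'
    proof -
      note ex = exclusiveD[OF leafD(1)[OF m]]
      have "sinv S m \<in> R'"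
        using profile_ex[OF \<P> T_in[OF ex(1)]] ex(4) that(2,3) by blast
      moreover have "underlying S m \<in> canonical_tree S \<P>"
        unfolding N using m ex(2) by (auto simp: leaves_def)
      ultimately show ?thesis using ex(3) by blast
    qed
    from n consider "leaf S (T n) (\<Q> n) P \<noteq> {}" | "leaf S (T n) (\<Q> n) Q \<noteq> {}"
      using leaf_exists by (auto simp: \<Q>_suc)
    then show "\<exists>s\<in>canonical_tree S \<P>. distinguishes S s P Q"
    proof cases
      case 1
      then obtain m where "m \<in> leaf S (T n) (\<Q> n) P" by blast
      note sep = leaf_separates[OF this n(2) PQ(3)[symmetric]]
      then have "distinguishes S (underlying S m) P Q"
        by (simp add: distinguishes_def underlying_def)
      then show ?thesis using sep by blast
    next
      case 2
      then obtain m where m: "m \<in> leaf S (T n) (\<Q> n) Q" by blast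
      note sep = leaf_separates[OF m n(1) PQ(3)]
      have "sinv S (sinv S m) = m" using leaf_in[OF m] T_in by simp
      then have "distinguishes S (underlying S m) P Q"
        using sep by (simp add: distinguishes_def underlying_def)
      then show ?thesis using sep by blast
    qed
  qed
  moreover have "canonical_tree S \<P> \<subseteq> unoriented S"
    using L_in by (auto simp: N unoriented_def)
  moreover have "image \<phi> ` canonical_tree S \<P> = canonical_tree S' (image \<phi> ` \<P>)"
    if "sepsys_iso S S' \<phi>" for S' \<phi>
  proof -
    have "\<P> \<subseteq> Pow (carrier S)" using \<P> profile_in by blast
    moreover have "iso_pair S S' \<phi>" by (rule iso_pair.intro[OF that inv_in])
    ultimately show ?thesis by (rule iso_pair.iso_canonical_tree[rotated])
  qed
  ultimately show "canonical_tree S \<P> \<subseteq> unoriented S \<and> nested_set S (canonical_tree S \<P>) \<and>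
      distinguishes_set S (canonical_tree S \<P>) \<P> \<and>
      (\<forall>S' \<phi>. separation_system S' \<and> sepsys_iso S S' \<phi> \<longrightarrow>
        image \<phi> ` canonical_tree S \<P> = canonical_tree S' (image \<phi> ` \<P>))"
    by blast
qed

end
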